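(* If $G$ is a randomly $3$-dimensional graph, then $G$ is $3$-connected.
   Context: All graphs are finite, simple and connected. A graph is $k$-connected if every separating set (a vertex set whose removal leaves at least two components) has at least $k$ vertices. For an ordered set $W=\{w_1,\dots,w_k\}\subseteq V(G)$ and $v\in V(G)$, $r(v|W)=(d(v,w_1),\dots,d(v,w_k))$, where $d$ denotes graph distance. $W$ is a resolving set if distinct vertices have distinct representations with respect to $W$; a basis is a minimum-size resolving set and its size is the metric dimension $\beta(G)$. $G$ is randomly $k$-dimensional if $\beta(G)=k$ and every $k$-subset of $V(G)$ is a basis of $G$. *)

theory Defs
  imports "Graph_Theory.Graph_Theory"
begin

text \<open>Undirected graphs are symmetric digraphs, each edge being a pair of opposite arcs; the locale
  \<^locale>\<open>graph\<close> describes the finite simple ones. All definitions below are meant for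
  such graphs.\<close>

definition graph_dist :: "('a, 'b) pre_digraph \<Rightarrow> 'a \<Rightarrow> 'a \<Rightarrow> ereal" where
  "graph_dist G u v = wf_digraph.\<mu> G (\<lambda>_. 1) u v"

text \<open>An ordered vertex set is given as a distinct list.\<close>

definition metric_rep :: "('a, 'b) pre_digraph \<Rightarrow> 'a list \<Rightarrow> 'a \<Rightarrow> ereal list" where
  "metric_rep G ws v = map (\<lambda>w. graph_dist G v w) ws"

text \<open>Whether representations are distinct does not depend on the chosen order of \<open>W\<close>.\<close>

definition resolving_set :: "('a, 'b) pre_digraph \<Rightarrow> 'a set \<Rightarrow> bool" where
  "resolving_set G W \<longleftrightarrow> W \<subseteq> verts G \<and>
     (\<exists>ws. distinct ws \<and> set ws = W \<and>
       (\<forall>u \<in> verts G. \<forall>v \<in> verts G. u \<noteq> v \<longrightarrow> metric_rep G ws u \<noteq> metric_rep G ws v))"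

definition metric_basis :: "('a, 'b) pre_digraph \<Rightarrow> 'a set \<Rightarrow> bool" where
  "metric_basis G W \<longleftrightarrow> resolving_set G W \<and> (\<forall>W'. resolving_set G W' \<longrightarrow> card W \<le> card W')"

definition metric_dimension :: "('a, 'b) pre_digraph \<Rightarrow> nat" where
  "metric_dimension G = (LEAST k. \<exists>W. resolving_set G W \<and> card W = k)"

definition randomly_dimensional :: "nat \<Rightarrow> ('a, 'b) pre_digraph \<Rightarrow> bool" where
  "randomly_dimensional k G \<longleftrightarrow>
     metric_dimension G = k \<and> (\<forall>W. W \<subseteq> verts G \<and> card W = k \<longrightarrow> metric_basis G W)"

text \<open>In a symmetric digraph the strongly connected components are the components of the
  undirected graph.\<close>

definition separating_set :: "('a, 'b) pre_digraph \<Rightarrow> 'a set \<Rightarrow> bool" where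
  "separating_set G S \<longleftrightarrow>
     S \<subseteq> verts G \<and> 2 \<le> card (pre_digraph.sccs (G \<restriction> (verts G - S)))"

text \<open>No lower bound on the number of vertices is imposed, so complete graphs, which have no
  separating set, are \<open>k\<close>-connected for every \<open>k\<close>.\<close>

definition k_connected :: "nat \<Rightarrow> ('a, 'b) pre_digraph \<Rightarrow> bool" where
  "k_connected k G \<longleftrightarrow> (\<forall>S. separating_set G S \<longrightarrow> k \<le> card S)"

end

theory Submission
  imports Defs
begin

text \<open>In a randomly 3-dimensional graph no pair of vertices is equidistant from three vertices, while
  every two vertices have a pair equidistant from both; by counting, that pair is unique.

  A cut vertex \<open>x\<close> between \<open>a\<close> and \<open>b\<close> would also be equidistant from the pair belonging to \<open>{a, b}\<close>.
  Let \<open>{x, y}\<close> separate \<open>A\<close> from \<open>B\<close> with \<open>B\<close> of minimal size over all 2-separations. If \<open>B\<close> has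
  at least two vertices, minimality gives \<open>x\<close> two neighbours in \<open>B\<close>; these are equidistant from \<open>x\<close>
  and from every vertex of \<open>A\<close> that is no farther from \<open>x\<close> than from \<open>y\<close>, so \<open>A\<close> contains at most one
  such vertex. The same holds for \<open>y\<close>, so both sides have two vertices, and those of \<open>B\<close> are then
  adjacent to both \<open>x\<close> and \<open>y\<close>, hence equidistant from too many vertices. If \<open>B = {b}\<close>, then all
  distances to \<open>b\<close> are determined by those to \<open>x\<close> and \<open>y\<close>, and there are fewer pairs equidistant
  from \<open>b\<close> than 2-sets containing \<open>b\<close>.\<close>

text \<open>The argument speaks of distances alone, so the graph is replaced by its metric.
  Adjacency becomes distance 1, and \<open>step\<close>, which yields the first vertex of a
  geodesic, retains the graph structure.\<close>

locale randomly_3_dim_metric =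
  fixes V :: "'a set" and d :: "'a \<Rightarrow> 'a \<Rightarrow> nat"
  assumes finite_V: "finite V"
    and zero_iff: "u \<in> V \<Longrightarrow> v \<in> V \<Longrightarrow> d u v = 0 \<longleftrightarrow> u = v"
    and sym: "u \<in> V \<Longrightarrow> v \<in> V \<Longrightarrow> d u v = d v u"
    and triangle: "u \<in> V \<Longrightarrow> v \<in> V \<Longrightarrow> w \<in> V \<Longrightarrow> d u w \<le> d u v + d v w"
    and step: "u \<in> V \<Longrightarrow> v \<in> V \<Longrightarrow> u \<noteq> v \<Longrightarrow> \<exists>w\<in>V. d u w = 1 \<and> d u v = Suc (d w v)"
    and three_resolve: "W \<subseteq> V \<Longrightarrow> card W = 3 \<Longrightarrow> u \<in> V \<Longrightarrow> v \<in> V \<Longrightarrow> u \<noteq> v \<Longrightarrow>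
      \<exists>w\<in>W. d u w \<noteq> d v w"
    and two_not_resolve: "W \<subseteq> V \<Longrightarrow> card W = 2 \<Longrightarrow>
      \<exists>u\<in>V. \<exists>v\<in>V. u \<noteq> v \<and> (\<forall>w\<in>W. d u w = d v w)"
begin

section \<open>Pairs of vertices equidistant from others\<close>

lemma self_zero: "u \<in> V \<Longrightarrow> d u u = 0"
  by (simp add: zero_iff)

lemma no_three_equidistant:
  assumes "u \<in> V" "v \<in> V" "u \<noteq> v" "a \<in> V" "b \<in> V" "c \<in> V"
    and "a \<noteq> b" "a \<noteq> c" "b \<noteq> c"
    and "d u a = d v a" "d u b = d v b" "d u c = d v c"
  shows False
  using three_resolve[of "{a, b, c}" u v] assms by auto

lemma equidistant_pair:
  assumes "a \<in> V" "b \<in> V" "a \<noteq> b"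
  obtains u v where "u \<in> V" "v \<in> V" "u \<noteq> v" "d u a = d v a" "d u b = d v b"
  using two_not_resolve[of "{a, b}"] assms by auto

text \<open>Choosing for every 2-set a pair that it does not resolve is injective, since no pair is
  equidistant from three vertices; hence it is a bijection of the 2-sets.\<close>

lemma equidistant_pair_unique:
  assumes "u \<in> V" "v \<in> V" "u \<noteq> v" "u' \<in> V" "v' \<in> V" "u' \<noteq> v'" "a \<in> V" "b \<in> V" "a \<noteq> b"
    and "d u a = d v a" "d u b = d v b" "d u' a = d v' a" "d u' b = d v' b"
  shows "{u, v} = {u', v'}"
proof -
  define N where "N = {P. P \<subseteq> V \<and> card P = 2}"
  define eqd where "eqd P W \<longleftrightarrow> (\<forall>p\<in>P. \<forall>q\<in>P. \<forall>w\<in>W. d p w = d q w)" for P W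
  have "\<exists>P\<in>N. eqd P W" if W: "W \<in> N" for W
  proof -
    obtain u v where uv: "u \<in> V" "v \<in> V" "u \<noteq> v" "\<forall>w\<in>W. d u w = d v w"
      using two_not_resolve[of W] W by (auto simp: N_def)
    then have "{u, v} \<in> N" "eqd {u, v} W" by (auto simp: N_def eqd_def)
    then show ?thesis by blast
  qed
  then obtain f where f: "\<And>W. W \<in> N \<Longrightarrow> f W \<in> N \<and> eqd (f W) W" by metis
  have uniq: "W = W'" if "P \<in> N" "W \<in> N" "W' \<in> N" "eqd P W" "eqd P W'" for P W W'
  proof (rule ccontr)
    assume "W \<noteq> W'"
    have "card P = 2" "card W = 2" "card W' = 2" using that by (auto simp: N_def)
    then obtain p q r s r' s' where P: "P = {p, q}" "p \<noteq> q" and W: "W = {r, s}" "r \<noteq> s"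
      and W': "W' = {r', s'}" "r' \<noteq> s'" unfolding card_2_iff by metis
    obtain c where c: "c \<in> W'" "c \<noteq> r" "c \<noteq> s" using \<open>W \<noteq> W'\<close> W W' by auto
    have "{p, q, r, s, c} \<subseteq> V" using that P W c by (auto simp: N_def)
    moreover have "d p r = d q r" "d p s = d q s" "d p c = d q c"
      using that(4,5) P(1) W(1) c(1) unfolding eqd_def by blast+
    ultimately show False
      using no_three_equidistant[of p q r s c] P(2) W(2) c(2,3) by simp
  qed
  have "finite N" unfolding N_def using finite_V by simp
  moreover have "inj_on f N" using f uniq by (intro inj_onI) metis
  ultimately have surj: "f ` N = N" using f endo_inj_surj[of N f] by auto
  \<comment> \<open>By surjectivity \<open>{p, q}\<close> is the choice made for some 2-set
    \<open>W\<close>, and \<open>uniq\<close> identifies \<open>W\<close> with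
    \<open>{a, b}\<close>.\<close>
  have key: "f {a, b} = {p, q}" if "p \<in> V" "q \<in> V" "p \<noteq> q" "d p a = d q a" "d p b = d q b" for p q
  proof -
    have "{p, q} \<in> N" "{a, b} \<in> N" using that assms by (auto simp: N_def)
    then obtain W where W: "W \<in> N" "f W = {p, q}" using surj by (metis imageE)
    have "eqd {p, q} {a, b}" using that by (auto simp: eqd_def)
    then have "W = {a, b}" using uniq f W \<open>{p, q} \<in> N\<close> \<open>{a, b} \<in> N\<close> by metis
    then show ?thesis using W by simp
  qed
  show ?thesis using key[of u v] key[of u' v'] assms by simp
qed

section \<open>Separations with fewer than three vertices\<close>

text \<open>The sides need not be connected, so a vertex of \<open>S\<close> can be moved into a
  side in which it keeps all its neighbours outside \<open>S\<close>.\<close>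

definition separation :: "'a set \<Rightarrow> 'a set \<Rightarrow> 'a set \<Rightarrow> bool" where
  "separation A S B \<longleftrightarrow> A \<union> S \<union> B = V \<and> A \<inter> S = {} \<and> A \<inter> B = {} \<and> S \<inter> B = {} \<and>
     A \<noteq> {} \<and> B \<noteq> {} \<and> (\<forall>a\<in>A. \<forall>b\<in>B. d a b \<noteq> 1)"

lemma separation_sym: "separation A S B \<Longrightarrow> separation B S A"
  unfolding separation_def using sym
  by (smt (verit, ccfv_SIG) Int_commute Un_commute Un_iff sup_left_commute)

text \<open>A geodesic followed from \<open>a\<close> stays in \<open>A\<close> until it enters
  \<open>S\<close>, since no vertex of \<open>A\<close> is adjacent to one of
  \<open>B\<close>.\<close>

lemma separation_geodesic:
  assumes "separation A S B" "a \<in> A" "b \<in> B"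
  shows "\<exists>s\<in>S. d a b = d a s + d s b"
  using assms(2)
proof (induction "d a b" arbitrary: a rule: less_induct)
  case less
  have in_V: "a \<in> V" "b \<in> V" "a \<noteq> b" using less.prems assms by (auto simp: separation_def)
  then obtain w where w: "w \<in> V" "d a w = 1" "d a b = Suc (d w b)" using step by blast
  then consider "w \<in> A" | "w \<in> S" using less.prems assms by (auto simp: separation_def)
  then show ?case
  proof cases
    case 1
    then obtain s where s: "s \<in> S" "d w b = d w s + d s b" using less.hyps w by auto
    then have "s \<in> V" using assms by (auto simp: separation_def)
    then have "d a s \<le> Suc (d w s)" "d a b \<le> d a s + d s b"
      using triangle[of a w s] triangle[of a s b] in_V w by auto
    then show ?thesis using s w by (intro bexI[of _ s]) auto
  next
    case 2
    then show ?thesis using w by (intro bexI[of _ w]) auto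
  qed
qed

lemma not_separation_empty: "\<not> separation A {} B"
proof
  assume sep: "separation A {} B"
  then obtain a b where "a \<in> A" "b \<in> B" by (auto simp: separation_def)
  then show False using separation_geodesic[OF sep] by blast
qed

lemma not_separation_singleton: "\<not> separation A {x} B"
proof
  assume sep: "separation A {x} B"
  have geo: "d a b = d a x + d x b" "d b a = d b x + d x a" if "a \<in> A" "b \<in> B" for a b
    using separation_geodesic[OF sep that] separation_geodesic[OF separation_sym[OF sep] that(2,1)]
    by auto
  obtain a b where ab: "a \<in> A" "b \<in> B" using sep by (auto simp: separation_def)
  have V: "V = A \<union> {x} \<union> B" and in_V: "a \<in> V" "b \<in> V" "x \<in> V" "a \<noteq> b" "a \<noteq> x" "b \<noteq> x"
    using sep ab by (auto simp: separation_def)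
  obtain u v where uv: "u \<in> V" "v \<in> V" "u \<noteq> v" "d u a = d v a" "d u b = d v b"
    using equidistant_pair in_V by blast
  \<comment> \<open>Comparing distances to \<open>b\<close> gives \<open>d u x\<close> \<le>
    \<open>d v x\<close>, comparing distances to \<open>a\<close> gives the converse.\<close>
  have mixed: "d u x = d v x"
    if "u \<in> A" "v \<in> B" "d u a = d v a" "d u b = d v b" for u v
  proof -
    have "u \<in> V" "v \<in> V" using that V by auto
    then have "d u a \<le> d u x + d x a" "d v b \<le> d v x + d x b" using triangle in_V by auto
    then show ?thesis using geo(1)[OF that(1) ab(2)] geo(2)[OF ab(1) that(2)] that(3,4) by linarith
  qed
  have x0: "d x x = 0" using in_V self_zero by simp
  have "d u x = d v x"
  proof (cases "u \<in> B")
    case True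
    have ub: "d u a = d u x + d x a" using geo(2)[OF ab(1) True] .
    show ?thesis
    proof (cases "v \<in> B")
      case True
      then show ?thesis using geo(2)[OF ab(1) True] ub uv(4) by linarith
    next
      case False
      then consider "v = x" | "v \<in> A" using uv(2) V by blast
      then show ?thesis
      proof cases
        case 1
        then show ?thesis using ub uv(4) x0 by simp
      next
        case 2
        then show ?thesis using mixed[OF 2 True] uv(4,5) by simp
      qed
    qed
  next
    case False
    \<comment> \<open>This covers \<open>w = x\<close> too, so for two vertices outside
      \<open>B\<close> equal distances to \<open>b\<close> mean equal distances to
      \<open>x\<close>.\<close>
    have notB: "d w b = d w x + d x b" if "w \<in> V" "w \<notin> B" for w
    proof (cases "w = x")
      case True
      then show ?thesis using x0 by simp
    next
      case False
      then have "w \<in> A" using that V by blast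
      then show ?thesis using geo(1) ab(2) by blast
    qed
    show ?thesis
    proof (cases "v \<in> B")
      case True
      show ?thesis
      proof (cases "u = x")
        case True
        then show ?thesis using geo(2)[OF ab(1) \<open>v \<in> B\<close>] uv(4) x0 by simp
      next
        case False
        then have "u \<in> A" using \<open>u \<notin> B\<close> uv(1) V by blast
        then show ?thesis using mixed[OF _ True] uv(4,5) by simp
      qed
    next
      case False
      then show ?thesis using notB[OF uv(1) \<open>u \<notin> B\<close>] notB[OF uv(2)] uv(5) by linarith
    qed
  qed
  then show False using no_three_equidistant[of u v a b x] uv in_V by auto
qed

text \<open>Otherwise \<open>x\<close> could join \<open>A\<close>, and \<open>y\<close> alone would
  separate.\<close>

lemma separation_neighbour:
  assumes "separation A {x, y} B" "x \<noteq> y"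
  shows "\<exists>b\<in>B. d x b = 1"
proof (rule ccontr)
  assume "\<not> ?thesis"
  then have "separation (A \<union> {x}) {y} B" using assms by (auto simp: separation_def)
  then show False using not_separation_singleton by blast
qed

text \<open>The triangle inequality bounds \<open>d a b\<close> by both sums, and a geodesic through
  \<open>x\<close> or \<open>y\<close> attains one of them.\<close>

lemma separation_dist:
  assumes "separation A {x, y} B" "a \<in> A" "b \<in> B"
  shows "d a b = min (d a x + d x b) (d a y + d y b)"
proof -
  have "a \<in> V" "b \<in> V" "x \<in> V" "y \<in> V" using assms by (auto simp: separation_def)
  then have "d a b \<le> d a x + d x b" "d a b \<le> d a y + d y b" using triangle by auto
  then show ?thesis using separation_geodesic[OF assms] by auto
qed

text \<open>Apart from one vertex \<open>u0\<close>, \<open>A\<close> splits into the vertices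
  \<open>X\<close> nearer to \<open>x\<close> and \<open>Y\<close> nearer to \<open>y\<close>. Each
  \<open>{a, b}\<close> with \<open>a\<close> in \<open>X\<close> or \<open>Y\<close> has an
  equidistant pair with one member on each side. Sending \<open>a\<close> to the member in
  \<open>X\<close> is injective, which leaves no room for \<open>Y\<close>, although
  \<open>y\<close> has a neighbour there.\<close>

lemma not_separation_two_one:
  assumes "x \<noteq> y"
  shows "\<not> separation A {x, y} {b}"
proof
  assume sep: "separation A {x, y} {b}"
  have V: "V = A \<union> {x, y, b}" and in_V: "x \<in> V" "y \<in> V" "b \<in> V" "x \<noteq> b" "y \<noteq> b"
    and notA: "x \<notin> A" "y \<notin> A" "b \<notin> A" and A_V: "\<And>a. a \<in> A \<Longrightarrow> a \<in> V"
    using sep by (auto simp: separation_def)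
  have sep': "separation A {y, x} {b}" using sep by (simp add: insert_commute)
  have xb: "d x b = 1" "d y b = 1"
    using separation_neighbour[OF sep] separation_neighbour[OF sep'] assms by auto
  have bx: "d b x = 1" "d b y = 1" using xb sym in_V by auto
  have zeros: "d x x = 0" "d y y = 0" "d b b = 0" using self_zero in_V by auto
  have db: "d a b = Suc (min (d a x) (d a y))" if "a \<in> A" for a
    using separation_dist[OF sep that] xb by auto
  have pos: "d a x > 0" "d a y > 0" if "a \<in> A" for a
    using zero_iff[of a] that A_V notA in_V by (auto intro!: gr0I)
  have xb_pair: "{u, v} = {u', v'}"
    if "u \<in> V" "v \<in> V" "u \<noteq> v" "u' \<in> V" "v' \<in> V" "u' \<noteq> v'"
      and "s \<in> {x, y}" "d u s = d v s" "d u b = d v b" "d u' s = d v' s" "d u' b = d v' b"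
    for u v u' v' s
    using equidistant_pair_unique[of u v u' v' s b] that in_V by auto
  \<comment> \<open>By \<open>db\<close>, equal distances to \<open>x\<close> and \<open>y\<close>
    entail equal distances to \<open>b\<close>, a third vertex.\<close>
  have inj: "u = v" if "u \<in> A" "v \<in> A" "d u x = d v x" "d u y = d v y" for u v
    using no_three_equidistant[of u v x y b] that db A_V in_V assms by auto
  \<comment> \<open>The pair equidistant from \<open>x\<close> and \<open>y\<close> contains neither
    of them and by \<open>inj\<close> is not inside \<open>A\<close>. So it contains
    \<open>b\<close>, and its other member has the distances of \<open>b\<close>.\<close>
  obtain u0 where u0: "u0 \<in> A" "d u0 x = 1" "d u0 y = 1"
  proof -
    obtain u v where uv: "u \<in> V" "v \<in> V" "u \<noteq> v" "d u x = d v x" "d u y = d v y"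
      using equidistant_pair in_V assms by metis
    have nx: "u \<noteq> x" "v \<noteq> x" "u \<noteq> y" "v \<noteq> y"
      using uv zero_iff in_V zeros by metis+
    have "u = b \<or> v = b" using uv nx inj V by blast
    then show thesis using that[of u] that[of v] uv nx V bx by auto
  qed
  have u0b: "d u0 b = 2" using db u0 by simp
  \<comment> \<open>A second such vertex would make \<open>x\<close> and \<open>y\<close>
    equidistant from \<open>b\<close>, \<open>u0\<close> and \<open>a\<close>.\<close>
  have u0_unique: "a = u0" if "a \<in> A" "d a x = d a y" for a
  proof (rule ccontr)
    assume "a \<noteq> u0"
    then show False
      using no_three_equidistant[of x y b a u0] that u0 in_V A_V notA assms xb sym by (metis)
  qed
  txt \<open>One side of the bisector of \<open>s\<close> and \<open>t\<close>, where \<open>{s, t} = {x, y}\<close>: it contains a neighbour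
    of \<open>s\<close>, so the pair equidistant from \<open>s\<close> and \<open>b\<close> consists of that neighbour and \<open>u0\<close>.\<close>
  have side: "(\<exists>a\<in>A. d a s = 1 \<and> d a s < d a t) \<and>
      (\<forall>u\<in>A. \<forall>v\<in>A. d u s < d u t \<longrightarrow> d v s < d v t \<longrightarrow> d u s = d v s \<longrightarrow> u = v)"
    if st: "{s, t} = {x, y}" for s t
  proof -
    have s: "s \<in> {x, y}" and ts: "t \<in> {x, y}" "s \<noteq> t" using st assms by (auto simp: doubleton_eq_iff)
    have dbst: "d a b = Suc (min (d a s) (d a t))" if "a \<in> A" for a
      using db[OF that] st by (auto simp: doubleton_eq_iff)
    have s_V: "s \<in> V" "t \<in> V" using s ts in_V by auto
    have sA: "s \<notin> A" "t \<notin> A" using s ts notA by auto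
    have tt: "d t t = 0" "d s s = 0" using self_zero s_V by auto
    have sb: "d s b = 1" "d t b = 1" "d b s = 1" "d b t = 1" using s ts xb bx by auto
    \<comment> \<open>A step along a geodesic to \<open>s\<close> lowers the distance to
      \<open>s\<close> by one and that to \<open>t\<close> by at most one, so the vertex stays
      strictly nearer to \<open>s\<close>. Neither \<open>t\<close> nor \<open>b\<close> is so
      placed, hence the walk stays in \<open>A\<close> until it reaches \<open>s\<close>.\<close>
    have descend: "\<exists>a\<in>A. d a s = 1 \<and> d a s < d a t" if "a \<in> A" "d a s < d a t" for a
      using that
    proof (induction "d a s" arbitrary: a rule: less_induct)
      case less
      have "a \<in> V" "a \<noteq> s" using less.prems A_V sA by auto
      then obtain w where w: "w \<in> V" "d a w = 1" "d a s = Suc (d w s)" using step s_V by blast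
      show ?case
      proof (cases "w = s")
        case True
        then show ?thesis using less.prems w tt by auto
      next
        case False
        have "d a t \<le> d a w + d w t" using triangle \<open>a \<in> V\<close> w s_V by blast
        then have lt: "d w s < d w t" using w less.prems by linarith
        then have "w \<noteq> t" "w \<noteq> b" using tt sb by auto
        then have "w \<in> A" using w False V st by auto
        then show ?thesis using less.hyps[of w] w lt by auto
      qed
    qed
    \<comment> \<open>Otherwise \<open>d a b = Suc (d a t)\<close> on all of \<open>A\<close>. The
      pair equidistant from \<open>s\<close> and \<open>b\<close> lies in \<open>A\<close>, because
      \<open>d t b = 1\<close> while vertices of \<open>A\<close> are at distance at least 2 from
      \<open>b\<close>. It is then equidistant from \<open>t\<close> as well, against
      \<open>inj\<close>.\<close>
    have ex: "\<exists>a\<in>A. d a s < d a t"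
    proof (rule ccontr)
      assume neg: "\<not> ?thesis"
      have "s \<noteq> b" using s in_V by auto
      then obtain u v where uv: "u \<in> V" "v \<in> V" "u \<noteq> v" "d u s = d v s" "d u b = d v b"
        using equidistant_pair[of s b] in_V(3) s_V(1) by blast
      have "u \<noteq> b" "v \<noteq> b" using uv zero_iff in_V by metis+
      moreover have "u \<noteq> s" "v \<noteq> s" using uv zero_iff s_V by metis+
      moreover have "u \<noteq> t \<and> v \<noteq> t"
      proof (rule ccontr)
        assume "\<not> ?thesis"
        then obtain w where w: "w \<in> A" "d w b = 1"
          using uv calculation V st sb by auto
        then show False using db[OF w(1)] pos[OF w(1)] by auto
      qed
      ultimately have A: "u \<in> A" "v \<in> A" using uv V st by auto
      then have "d u t \<le> d u s" "d v t \<le> d v s" using neg by (auto simp: not_less)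
      then have "d u t = d v t" using dbst A uv(5) by (auto simp: min_def split: if_splits)
      then show False using inj[of u v] A uv st by (auto simp: doubleton_eq_iff)
    qed
    then obtain a where a: "a \<in> A" "d a s = 1" "d a s < d a t" using descend by blast
    have u0s: "d u0 s = 1" "d u0 t = 1" using u0 s ts by auto
    have "u = v" if uv: "u \<in> A" "v \<in> A" "d u s < d u t" "d v s < d v t" "d u s = d v s" for u v
    proof (rule ccontr)
      assume "u \<noteq> v"
      then have "{u, v} = {u0, a}"
        using uv a u0 u0s s dbst A_V by (intro xb_pair[where s = s]) auto
      then have "u = u0 \<or> v = u0" by blast
      then show False using uv u0s by auto
    qed
    then show ?thesis using a by blast
  qed
  define X where "X = {a \<in> A. d a x < d a y}"
  define Y where "Y = {a \<in> A. d a y < d a x}"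
  have uniqX: "\<And>u v. u \<in> X \<Longrightarrow> v \<in> X \<Longrightarrow> d u x = d v x \<Longrightarrow> u = v"
    using side[of x y] by (auto simp: X_def)
  have sideY: "\<exists>a\<in>Y. d a y = 1" and uniqY: "\<And>u v. u \<in> Y \<Longrightarrow> v \<in> Y \<Longrightarrow> d u y = d v y \<Longrightarrow> u = v"
    using side[of y x] by (auto simp: Y_def insert_commute)
  have AXY: "A = insert u0 (X \<union> Y)" 
  proof -
    have "a = u0 \<or> a \<in> X \<or> a \<in> Y" if "a \<in> A" for a
      using u0_unique[OF that] that unfolding X_def Y_def by (simp, linarith)
    then show ?thesis using u0(1) unfolding X_def Y_def by blast
  qed
  have disj: "X \<inter> Y = {}" "u0 \<notin> X" "u0 \<notin> Y" using u0(2,3) by (simp_all add: X_def Y_def) auto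
  have bX: "d a b = Suc (d a x)" if "a \<in> X" for a using that db by (auto simp: X_def)
  have bY: "d a b = Suc (d a y)" if "a \<in> Y" for a using that db by (auto simp: Y_def)
  have XY_V: "\<And>a. a \<in> X \<Longrightarrow> a \<in> V" "\<And>a. a \<in> Y \<Longrightarrow> a \<in> V" using A_V by (auto simp: X_def Y_def)
  txt \<open>Every pair equidistant from \<open>b\<close>, other than the three involving \<open>x\<close>, \<open>y\<close> or \<open>u0\<close>, joins
    the two sides; there are too few of these to serve all \<open>{a, b}\<close>.\<close>
  have "\<exists>u\<in>X. \<exists>v\<in>Y. d u a = d v a \<and> d u b = d v b" if a: "a \<in> X \<union> Y" for a
  proof -
    have aA: "a \<in> A" "a \<noteq> u0" "a \<in> V" using a AXY disj A_V by auto
    then have ab: "a \<noteq> b" "a \<noteq> x" "a \<noteq> y" using notA by auto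
    obtain u v where uv: "u \<in> V" "v \<in> V" "u \<noteq> v" "d u a = d v a" "d u b = d v b"
      using equidistant_pair[of a b] aA ab in_V by metis
    \<comment> \<open>Stated for one member so that it applies to the pair in both orders. At
      distance 1 from \<open>b\<close> only \<open>{x, y}\<close> would be possible, which forces
      \<open>a = u0\<close>; a pair of \<open>u0\<close> with a vertex of \<open>X\<close> or
      \<open>Y\<close> would be equidistant from \<open>x\<close> or \<open>y\<close> as a third
      vertex.\<close>
    have no: "v \<in> A \<and> v \<noteq> u0 \<and> (u \<in> X \<longrightarrow> v \<in> Y)"
      if uv: "u \<in> V" "v \<in> V" "u \<noteq> v" "d u a = d v a" "d u b = d v b" for u v
    proof -
      have nb: "v \<noteq> b" "u \<noteq> b" using uv zero_iff in_V by metis+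
      have Au: "d w b \<noteq> 1" if "w \<in> A" for w using db[OF that] pos[OF that] by auto
      have "v \<notin> {x, y}"
      proof
        assume v: "v \<in> {x, y}"
        then have "u \<notin> A" using Au uv xb by auto
        then have "{u, v} = {x, y}" using uv v nb V by auto
        then have "d x a = d y a" using uv by (auto simp: doubleton_eq_iff)
        then show False using u0_unique[of a] aA sym in_V by auto
      qed
      then have vA: "v \<in> A" using nb uv V by auto
      have uA: "u \<in> A"
      proof (rule ccontr)
        assume "u \<notin> A"
        then show False using Au[OF vA] uv nb V xb by auto
      qed
      have "v \<noteq> u0"
      proof
        assume v: "v = u0"
        then have "u \<in> X \<union> Y" using uA uv AXY by auto
        then show False
        proof
          assume "u \<in> X"
          then have "d u x = d v x" using bX uv u0 u0b v by auto
          then show False using no_three_equidistant[of u v a b x] uv aA ab in_V by auto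
        next
          assume "u \<in> Y"
          then have "d u y = d v y" using bY uv u0 u0b v by auto
          then show False using no_three_equidistant[of u v a b y] uv aA ab in_V by auto
        qed
      qed
      moreover have "v \<notin> X" if "u \<in> X" using that uniqX[of u v] bX uv by auto
      ultimately show ?thesis using vA AXY by auto
    qed
    have "v \<in> A \<and> v \<noteq> u0 \<and> (u \<in> X \<longrightarrow> v \<in> Y)" using no uv by blast
    moreover have "u \<in> A \<and> u \<noteq> u0 \<and> (v \<in> X \<longrightarrow> u \<in> Y)" using no[of v u] uv by auto
    moreover have "\<not> (u \<in> Y \<and> v \<in> Y)" using uniqY[of u v] bY uv by auto
    ultimately have "u \<in> X \<and> v \<in> Y \<or> v \<in> X \<and> u \<in> Y" using AXY by auto
    then show ?thesis using uv by metis
  qed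
  then obtain f g where fg: "\<And>a. a \<in> X \<union> Y \<Longrightarrow>
      f a \<in> X \<and> g a \<in> Y \<and> d (f a) a = d (g a) a \<and> d (f a) b = d (g a) b" by metis
  \<comment> \<open>If \<open>f a = f c\<close>, then \<open>g a\<close> and \<open>g c\<close> have
    the same distance to \<open>b\<close> and coincide by \<open>uniqY\<close>; this pair would be
    equidistant from \<open>a\<close>, \<open>c\<close> and \<open>b\<close>.\<close>
  have "inj_on f (X \<union> Y)"
  proof (rule inj_onI, rule ccontr)
    fix a c assume ac: "a \<in> X \<union> Y" "c \<in> X \<union> Y" "f a = f c" "a \<noteq> c"
    have "g a = g c" using fg[OF ac(1)] fg[OF ac(2)] ac(3) uniqY bY by (metis Suc_inject)
    moreover have "a \<noteq> b" "c \<noteq> b" using ac AXY notA by auto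
    moreover have "f a \<noteq> g a" using fg[OF ac(1)] disj by auto
    ultimately show False
      using no_three_equidistant[of "f a" "g a" a c b] fg[OF ac(1)] fg[OF ac(2)] ac XY_V in_V by auto
  qed
  moreover have "finite X" "finite Y" using XY_V finite_V by (meson finite_subset subsetI)+
  moreover have "f ` (X \<union> Y) \<subseteq> X" using fg by auto
  ultimately have "card (X \<union> Y) \<le> card X" by (meson card_inj_on_le)
  then have "card Y = 0" using disj \<open>finite X\<close> \<open>finite Y\<close> by (simp add: card_Un_disjoint)
  then show False using sideY \<open>finite Y\<close> by auto
qed

text \<open>If \<open>b\<close> were the only neighbour of \<open>x\<close> in \<open>B\<close>,
  then \<open>x\<close> could join \<open>A\<close> and \<open>b\<close> replace it in the
  separator, leaving the smaller nonempty side \<open>B - {b}\<close>.\<close>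

lemma separation_two_neighbours:
  assumes sep: "separation A {x, y} B" and "x \<noteq> y" "card B \<noteq> 1"
    and min: "\<forall>A' B' x' y'. separation A' {x', y'} B' \<longrightarrow> x' \<noteq> y' \<longrightarrow> card B \<le> card B'"
  obtains b c where "b \<in> B" "c \<in> B" "b \<noteq> c" "d x b = 1" "d x c = 1"
proof -
  have fin: "finite B" using finite_V sep by (metis Un_infinite separation_def sup_commute)
  obtain b where b: "b \<in> B" "d x b = 1" using separation_neighbour[OF sep \<open>x \<noteq> y\<close>] by blast
  have "\<exists>c\<in>B. c \<noteq> b \<and> d x c = 1"
  proof (rule ccontr)
    assume neg: "\<not> ?thesis"
    have "B - {b} \<noteq> {}" using b \<open>card B \<noteq> 1\<close> by (metis card_1_singleton_iff insert_Diff One_nat_def)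
    then have "separation (A \<union> {x}) {b, y} (B - {b})"
      using sep neg b \<open>x \<noteq> y\<close> by (auto simp: separation_def)
    moreover have "b \<noteq> y" using sep b by (auto simp: separation_def)
    ultimately have "card B \<le> card (B - {b})" using min by blast
    then show False using b fin by (metis card_Diff1_less not_less)
  qed
  then show thesis using that b by blast
qed

lemma not_separation_two:
  assumes "x \<noteq> y"
  shows "\<not> separation A {x, y} B"
proof
  assume "separation A {x, y} B"
  define P where "P n \<longleftrightarrow> (\<exists>A x y B. separation A {x, y} B \<and> x \<noteq> y \<and> card B = n)" for n
  have "P (card B)" using assms \<open>separation A {x, y} B\<close> by (auto simp: P_def)
  then have "P (LEAST n. P n)" by (rule LeastI)
  then obtain A x y B where sep: "separation A {x, y} B" and ne: "x \<noteq> y" and least: "card B = (LEAST n. P n)"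
    by (auto simp: P_def)
  have min: "\<forall>A' B' x' y'. separation A' {x', y'} B' \<longrightarrow> x' \<noteq> y' \<longrightarrow> card B \<le> card B'"
    unfolding least by (intro allI impI Least_le) (auto simp: P_def)
  have sep': "separation A {y, x} B" using sep by (simp add: insert_commute)
  have fin: "finite A" "finite B" and nonempty: "B \<noteq> {}" "A \<noteq> {}"
    using finite_V sep by (auto simp: separation_def)
  have card1: "card B \<noteq> 1" using not_separation_two_one[OF ne] sep by (metis card_1_singletonE)
  \<comment> \<open>The bound variables \<open>x\<close> and \<open>y\<close> allow use with the two
    exchanged. As \<open>d y b\<close> and \<open>d y c\<close> are at least 1, the route through
    \<open>x\<close> is shortest for such \<open>a\<close>, so the neighbours \<open>b\<close>,
    \<open>c\<close> of \<open>x\<close> are equidistant from \<open>a\<close>, \<open>a'\<close>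
    and \<open>x\<close>.\<close>
  have half: "a = a'"
    if sep: "separation A {x, y} B" "x \<noteq> y"
      and a: "a \<in> A" "d a x \<le> d a y" "a' \<in> A" "d a' x \<le> d a' y" for x y a a'
  proof (rule ccontr)
    assume "a \<noteq> a'"
    obtain b c where bc: "b \<in> B" "c \<in> B" "b \<noteq> c" "d x b = 1" "d x c = 1"
      using separation_two_neighbours[OF sep card1 min] by blast
    have in_V: "x \<in> V" "y \<in> V" "b \<in> V" "c \<in> V" "a \<in> V" "a' \<in> V" "a \<noteq> x" "a' \<noteq> x" "y \<noteq> b" "y \<noteq> c"
      using sep a bc by (auto simp: separation_def)
    have "d y b \<noteq> 0" "d y c \<noteq> 0" using in_V zero_iff by auto
    then have e: "d e b = d e c" if "e \<in> A" "d e x \<le> d e y" for e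
      using separation_dist[OF sep(1) that(1)] bc that by auto
    have "d b a = d c a" "d b a' = d c a'" "d b x = d c x"
      using e[of a] e[of a'] a bc sym in_V by auto
    then show False using no_three_equidistant[of b c a a' x] in_V bc \<open>a \<noteq> a'\<close> by auto
  qed
  obtain a where a: "a \<in> A" using nonempty by auto
  have "card A \<le> 2"
  proof -
    have "card {a \<in> A. d a x \<le> d a y} \<le> 1"
      using half[OF sep ne] fin by (subst card_le_Suc0_iff_eq[folded One_nat_def]) auto
    moreover have "card {a \<in> A. d a y \<le> d a x} \<le> 1"
      using half[OF sep' ne[symmetric]] fin by (subst card_le_Suc0_iff_eq[folded One_nat_def]) auto
    moreover have "{a \<in> A. d a x \<le> d a y} \<union> {a \<in> A. d a y \<le> d a x} = A" by auto
    ultimately show ?thesis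
      using card_Un_le[of "{a \<in> A. d a x \<le> d a y}" "{a \<in> A. d a y \<le> d a x}"] by simp
  qed
  \<comment> \<open>Minimality also covers the separation with its sides exchanged, so
    \<open>card B\<close> \<le> \<open>card A\<close>.\<close>
  then have "card B \<le> 2" using min separation_sym[OF sep] ne by fastforce
  moreover obtain b c where bc: "b \<in> B" "c \<in> B" "b \<noteq> c" "d x b = 1" "d x c = 1"
    using separation_two_neighbours[OF sep ne card1 min] by blast
  ultimately have B: "B = {b, c}"
    using fin by (intro card_seteq[symmetric]) auto
  obtain b' c' where bc': "b' \<in> B" "c' \<in> B" "b' \<noteq> c'" "d y b' = 1" "d y c' = 1"
    using separation_two_neighbours[OF sep' ne[symmetric] card1 min] by blast
  \<comment> \<open>With only two vertices in \<open>B\<close>, the neighbours of \<open>y\<close>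
    there are again \<open>b\<close> and \<open>c\<close>.\<close>
  then have yb: "d y b = 1" "d y c = 1" using B by auto
  have in_V: "x \<in> V" "y \<in> V" "b \<in> V" "c \<in> V" "a \<in> V" "a \<noteq> x" "a \<noteq> y"
    using sep a bc by (auto simp: separation_def)
  have "d a b = d a c" using separation_dist[OF sep a] bc yb by auto
  then have "d b a = d c a" "d b x = d c x" "d b y = d c y" using sym in_V bc yb by auto
  then show False using no_three_equidistant[of b c a x y] in_V bc ne by auto
qed

lemma separation_card_ge_3:
  assumes "separation A S B"
  shows "3 \<le> card S"
proof (rule ccontr)
  assume "\<not> 3 \<le> card S"
  moreover have "finite S" using assms finite_V by (auto simp: separation_def)
  ultimately consider "S = {}" | "card S = 1" | "card S = 2"
    using card_0_eq[of S] by linarith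
  then show False
    using assms not_separation_empty not_separation_singleton not_separation_two
    by cases (auto simp: card_1_singleton_iff card_2_iff)
qed

end

section \<open>Graph distance as a natural number\<close>

text \<open>The value is meaningful only when some walk exists, hence the reachability premises
  below.\<close>

definition (in pre_digraph) hop_dist :: "'a \<Rightarrow> 'a \<Rightarrow> nat" where
  "hop_dist u v = (LEAST n. \<exists>p. awalk u p v \<and> length p = n)"

context wf_digraph
begin

lemma hop_dist_le: "awalk u p v \<Longrightarrow> hop_dist u v \<le> length p"
  unfolding hop_dist_def by (rule Least_le) blast

lemma hop_dist_awalk:
  assumes "u \<rightarrow>\<^sup>* v"
  obtains p where "awalk u p v" "length p = hop_dist u v"
proof -
  have "\<exists>n p. awalk u p v \<and> length p = n" using assms by (auto simp: reachable_awalk)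
  then have "\<exists>p. awalk u p v \<and> length p = hop_dist u v" unfolding hop_dist_def by (rule LeastI_ex)
  then show thesis using that by blast
qed

text \<open>With unit costs \<open>\<mu>\<close> is an infimum of walk lengths, attained by a
  shortest walk.\<close>

lemma graph_dist_eq_hop_dist:
  assumes "u \<rightarrow>\<^sup>* v"
  shows "graph_dist G u v = ereal (real (hop_dist u v))"
proof -
  have cost: "awalk_cost (\<lambda>_. 1) p = real (length p)" for p :: "'b awalk" by (induction p) auto
  obtain p where p: "awalk u p v" "length p = hop_dist u v" using hop_dist_awalk[OF assms] .
  show ?thesis unfolding graph_dist_def \<mu>_def cost
  proof (rule antisym)
    show "(INF p\<in>{p. awalk u p v}. ereal (real (length p))) \<le> ereal (real (hop_dist u v))"
      using p by (intro INF_lower2[of p]) auto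
    show "ereal (real (hop_dist u v)) \<le> (INF p\<in>{p. awalk u p v}. ereal (real (length p)))"
      using hop_dist_le by (intro INF_greatest) auto
  qed
qed

lemma hop_dist_triangle:
  assumes "u \<rightarrow>\<^sup>* v" "v \<rightarrow>\<^sup>* w"
  shows "hop_dist u w \<le> hop_dist u v + hop_dist v w"
proof -
  obtain p where p: "awalk u p v" "length p = hop_dist u v" using hop_dist_awalk[OF assms(1)] .
  obtain q where q: "awalk v q w" "length q = hop_dist v w" using hop_dist_awalk[OF assms(2)] .
  have "awalk u (p @ q) w" using p q by (meson awalk_appendI)
  then show ?thesis using hop_dist_le[of u "p @ q" w] p(2) q(2) by simp
qed

lemma hop_dist_eq_0_iff:
  assumes "u \<rightarrow>\<^sup>* v"
  shows "hop_dist u v = 0 \<longleftrightarrow> u = v"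
proof
  assume "hop_dist u v = 0"
  then show "u = v" using hop_dist_awalk[OF assms] by (metis awalk_Nil_iff length_0_conv)
next
  assume "u = v"
  then have "awalk u [] v" using assms by (auto simp: awalk_Nil_iff reachable_in_verts)
  then show "hop_dist u v = 0" using hop_dist_le[of u "[]" v] by simp
qed

lemma hop_dist_eq_1_dominates:
  assumes "u \<rightarrow>\<^sup>* v" "hop_dist u v = 1"
  shows "u \<rightarrow> v"
proof -
  obtain p where p: "awalk u p v" "length p = 1" using hop_dist_awalk[OF assms(1)] assms(2) by metis
  then obtain e where "p = [e]" by (auto simp: length_Suc_conv)
  then show ?thesis using p by (auto simp: awalk_simps dest: in_arcs_imp_in_arcs_ends)
qed

text \<open>\<open>w\<close> is the second vertex of a shortest walk; the triangle inequality turns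
  the length bounds for its two pieces into equalities.\<close>

lemma hop_dist_step:
  assumes "u \<rightarrow>\<^sup>* v" "u \<noteq> v"
  obtains w where "w \<in> verts G" "hop_dist u w = 1" "hop_dist u v = Suc (hop_dist w v)"
proof -
  obtain p where p: "awalk u p v" "length p = hop_dist u v" using hop_dist_awalk[OF assms(1)] .
  then obtain e q where eq: "p = e # q" using assms(2) by (cases p) (auto simp: awalk_Nil_iff)
  let ?w = "head G e"
  have e: "e \<in> arcs G" "u = tail G e" and q: "awalk ?w q v" using p eq by (auto simp: awalk_Cons_iff)
  have w1: "awalk u [e] ?w" using e arc_implies_awalk by simp
  then have reach: "u \<rightarrow>\<^sup>* ?w" "?w \<rightarrow>\<^sup>* v" using q by (auto intro: reachable_awalkI)
  have le: "hop_dist u v \<le> hop_dist u ?w + hop_dist ?w v"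
    by (rule hop_dist_triangle[OF reach])
  have "hop_dist u ?w \<le> 1" "hop_dist ?w v \<le> length q"
    using hop_dist_le[OF w1] hop_dist_le[OF q] by auto
  then have "hop_dist u ?w = 1" "hop_dist u v = Suc (hop_dist ?w v)"
    using le p(2) eq by auto
  then show thesis using that[of ?w] e(1) by simp
qed

end

section \<open>Symmetry of distance, and separating sets as partitions\<close>

lemma (in sym_digraph) awalk_reverse:
  "awalk u p v \<Longrightarrow> \<exists>q. awalk v q u \<and> length q = length p"
proof (induction p arbitrary: u)
  case (Cons e p)
  then have e: "e \<in> arcs G" "u = tail G e" "awalk (head G e) p v" by (auto simp: awalk_Cons_iff)
  obtain q where q: "awalk v q (head G e)" "length q = length p" using Cons.IH e by blast
  obtain e' where e': "e' \<in> arcs G" "tail G e' = head G e" "head G e' = tail G e"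
    using sym_arcs e(1) unfolding symmetric_conv by metis
  then have "awalk (head G e) [e'] u" using e arc_implies_awalk[of e'] by simp
  then have "awalk v (q @ [e']) u" using q by (meson awalk_appendI)
  then show ?case using q by (intro exI[of _ "q @ [e']"]) simp
qed (auto simp: awalk_Nil_iff)

lemma (in sym_digraph) hop_dist_commute: "hop_dist u v = hop_dist v u"
proof -
  have "(\<exists>p. awalk u p v \<and> length p = n) \<longleftrightarrow> (\<exists>p. awalk v p u \<and> length p = n)" for n
    using awalk_reverse by metis
  then show ?thesis unfolding hop_dist_def by simp
qed

text \<open>\<open>A\<close> is the component of one vertex after removal of \<open>S\<close>, and
  \<open>B\<close> collects all other components.\<close>

lemma (in graph) separating_set_partition:
  assumes "separating_set G S"
  obtains A B where "A \<union> S \<union> B = verts G" "A \<inter> S = {}" "A \<inter> B = {}" "S \<inter> B = {}"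
    "A \<noteq> {}" "B \<noteq> {}" "\<forall>a\<in>A. \<forall>b\<in>B. \<not> a \<rightarrow> b"
proof -
  define H where "H = G \<restriction> (verts G - S)"
  have "induced_subgraph H G" unfolding H_def by (rule induced_induce) auto
  then interpret H: sym_digraph H by (rule induced_graph_imp_graph)
  have S: "S \<subseteq> verts G" and "2 \<le> card H.sccs" using assms by (auto simp: separating_set_def H_def)
  then have "2 \<le> card H.sccs_verts" by (simp add: H.card_sccs_verts)
  \<comment> \<open>Infinite sets have cardinality 0, so the bound also yields finiteness.\<close>
  then have "\<not> card H.sccs_verts \<le> Suc 0" "finite H.sccs_verts" by (auto intro: card_ge_0_finite)
  then obtain C D where CD: "C \<in> H.sccs_verts" "D \<in> H.sccs_verts" "C \<noteq> D"
    by (meson card_le_Suc0_iff_eq)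
  then obtain a b where ab: "a \<in> C" "b \<in> D" by (auto simp: H.in_sccs_verts_conv_reachable)
  have "b \<notin> C" using H.sccs_verts_disjoint CD ab by blast
  then have nreach: "\<not> a \<rightarrow>\<^sup>*\<^bsub>H\<^esub> b"
    using CD(1) ab(1) H.symmetric_reachable' unfolding H.in_sccs_verts_conv_reachable by blast
  have in_H: "a \<in> verts H" "b \<in> verts H" using CD ab H.sccs_verts_subsets by blast+
  have verts_H: "verts H = verts G - S" by (simp add: H_def)
  define A where "A = {v. a \<rightarrow>\<^sup>*\<^bsub>H\<^esub> v}"
  have "A \<subseteq> verts H" using H.reachable_in_verts by (auto simp: A_def)
  have noarc: "\<not> u \<rightarrow> v" if "u \<in> A" "v \<in> verts H - A" for u v
  proof
    assume "u \<rightarrow> v"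
    then obtain e where "e \<in> arcs G" "tail G e = u" "head G e = v" by (auto simp: arcs_ends_conv)
    moreover have "u \<in> verts H" using that \<open>A \<subseteq> verts H\<close> by blast
    ultimately have "u \<rightarrow>\<^bsub>H\<^esub> v" using that(2) verts_H by (auto simp: H_def arcs_ends_conv)
    then have "a \<rightarrow>\<^sup>*\<^bsub>H\<^esub> v" using that(1) H.reachable_adj_trans by (auto simp: A_def)
    then show False using that(2) by (simp add: A_def)
  qed
  show thesis
  proof (rule that[of A "verts H - A"])
    show "A \<noteq> {}" using in_H by (auto simp: A_def)
    show "verts H - A \<noteq> {}" using in_H nreach by (auto simp: A_def)
  qed (use S \<open>A \<subseteq> verts H\<close> verts_H noarc in auto)
qed

section \<open>Transfer to randomly 3-dimensional graphs\<close>

theorem mainTheorem6: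
  fixes G :: "('a, 'b) pre_digraph"
  assumes "graph G" and "Digraph_Component.connected G"
    and "randomly_dimensional 3 G"
  shows "k_connected 3 G"
proof -
  interpret graph G by fact
  have reach: "u \<rightarrow>\<^sup>*\<^bsub>G\<^esub> v" if "u \<in> verts G" "v \<in> verts G" for u v
    using symmetric_connected_imp_strongly_connected[OF sym_arcs assms(2)] that by auto
  have gd: "graph_dist G u v = ereal (real (hop_dist u v))" if "u \<in> verts G" "v \<in> verts G" for u v
    using graph_dist_eq_hop_dist reach that by blast
  \<comment> \<open>Connectedness makes all distances finite, so \<open>hop_dist\<close> can replace
    \<open>graph_dist\<close>, and the order of the list disappears.\<close>
  have resolving: "resolving_set G W \<longleftrightarrow> W \<subseteq> verts G \<and>
      (\<forall>u\<in>verts G. \<forall>v\<in>verts G. u \<noteq> v \<longrightarrow> (\<exists>w\<in>W. hop_dist u w \<noteq> hop_dist v w))" for W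
  proof (cases "W \<subseteq> verts G")
    case True
    then have "finite W" using finite_verts finite_subset by blast
    then have dl: "\<exists>ws. distinct ws \<and> set ws = W" using finite_distinct_list by blast
    have "metric_rep G ws u \<noteq> metric_rep G ws v \<longleftrightarrow> (\<exists>w\<in>W. hop_dist u w \<noteq> hop_dist v w)"
      if "set ws = W" "u \<in> verts G" "v \<in> verts G" for ws u v
    proof -
      have "graph_dist G u w = graph_dist G v w \<longleftrightarrow> hop_dist u w = hop_dist v w" if "w \<in> W" for w
        using gd True \<open>u \<in> verts G\<close> \<open>v \<in> verts G\<close> that by auto
      then show ?thesis unfolding metric_rep_def using that(1) by auto
    qed
    then show ?thesis unfolding resolving_set_def using True dl by (smt (verit, best))
  qed (simp add: resolving_set_def)
  interpret M: randomly_3_dim_metric "verts G" hop_dist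
  proof
    fix W u v
    assume "W \<subseteq> verts G" "card W = 3" "u \<in> verts G" "v \<in> verts G" "u \<noteq> v"
    then show "\<exists>w\<in>W. hop_dist u w \<noteq> hop_dist v w"
      using assms(3) resolving[of W] unfolding randomly_dimensional_def metric_basis_def by blast
  next
    fix W
    assume W: "W \<subseteq> verts G" "card W = 2"
    have "\<not> resolving_set G W"
    proof
      assume "resolving_set G W"
      then have "metric_dimension G \<le> 2"
        unfolding metric_dimension_def using W(2) by (intro Least_le) blast
      then show False using assms(3) by (simp add: randomly_dimensional_def)
    qed
    then show "\<exists>u\<in>verts G. \<exists>v\<in>verts G. u \<noteq> v \<and> (\<forall>w\<in>W. hop_dist u w = hop_dist v w)"
      using resolving W(1) by blast
  next
    fix u v assume "u \<in> verts G" "v \<in> verts G" "u \<noteq> v"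
    then show "\<exists>w\<in>verts G. hop_dist u w = 1 \<and> hop_dist u v = Suc (hop_dist w v)"
      using hop_dist_step reach by metis
  qed (use hop_dist_triangle reach hop_dist_eq_0_iff hop_dist_commute in auto)
  show ?thesis unfolding k_connected_def
  proof (intro allI impI)
    fix S assume "separating_set G S"
    then obtain A B where AB: "A \<union> S \<union> B = verts G" "A \<inter> S = {}" "A \<inter> B = {}" "S \<inter> B = {}"
      "A \<noteq> {}" "B \<noteq> {}" and noarc: "\<forall>a\<in>A. \<forall>b\<in>B. \<not> a \<rightarrow>\<^bsub>G\<^esub> b"
      by (rule separating_set_partition)
    have "hop_dist a b \<noteq> 1" if "a \<in> A" "b \<in> B" for a b
      using hop_dist_eq_1_dominates[of a b] reach[of a b] noarc AB(1) that by blast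
    then have "M.separation A S B" unfolding M.separation_def using AB by blast
    then show "3 \<le> card S" by (rule M.separation_card_ge_3)
  qed
qed

end
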